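(* Let $\mathcal T^h$ be a Voronoi mesh for $\Omega$, $\kappa,\delta t>0$, and let $W:\mathbb R^d\to\mathbb R$ satisfy $W(x)=W(-x)\ge 0$, $W\in C^1(\mathbb R^d\setminus\{0\})$, and $W$ Lipschitz. Let $\{\rho_K^n\}_{K,n}$ be a solution to the Scharfetter--Gummel scheme with initial datum in $\mathcal P(\mathcal T^h)$. Then for any $n\in\mathbb N_0$ it holds that $$\frac{\mathcal F^h(\rho^{n+1})-\mathcal F^h(\rho^n)}{\delta t}+\kappa\,\frac{\mathcal H(\rho^n\mid\rho^{n+1})}{\delta t}=-\mathcal D^h(\rho^{n+1}),$$ where $\mathcal D^h$ is the dissipation functional given by $$\mathcal D^h(\rho^{n+1})=\frac12\sum_K\sum_{L\sim K}\frac{\kappa|K|L|}{d_{KL}}\,\alpha_\kappa\big(\rho_K^{n+1},\rho_L^{n+1};d_{KL}q_{KL}^{n+1}\big)\ \ge 0,$$ with $$\alpha_\kappa(a,b;v)=\Big(\log\big(a e^{\frac{v}{2\kappa}}\big)-\log\big(be^{-\frac{v}{2\kappa}}\big)\Big)\,\theta_\kappa(a,b;v),\qquad \theta_\kappa(a,b;v)=\begin{cases} v\,\dfrac{ae^{\frac{v}{2\kappa}}-be^{-\frac{v}{2\kappa}}}{e^{\frac{v}{2\kappa}}-e^{-\frac{v}{2\kappa}}},& v\ne0,\\ \kappa(a-b),& v=0.\end{cases}$$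
   Context: Mesh. $\Omega\subset\mathbb R^d$ is a bounded domain with smooth boundary. A Voronoi mesh $\mathcal T^h$ for $\Omega$ is a finite family of cells of a Voronoi tesselation that covers $\Omega$, such that each cell $K$ is compact, $K\cap\Omega\neq\emptyset$ and $\mathrm{diam}(K)\le h$. The generator of $K$ is $x_K\in K$, and $d_{KL}=|x_K-x_L|$. Two distinct cells $K,L\in\mathcal T^h$ are neighbors, $L\sim K$, if they share a face $K|L=K\cap L$ of positive $(d-1)$-dimensional area $|K|L|$; $\tau_{KL}=|K|L|/d_{KL}$. $|K|$ is the volume of $K$. The double sum $\sum_K\sum_{L\sim K}$ runs over ordered pairs of neighbors. Discrete probabilities: $\mathcal P(\mathcal T^h)=\{\{\rho_K\}_{K\in\mathcal T^h}:\rho_K\ge 0\ \forall K,\ \sum_K|K|\rho_K=1\}$. Scheme. Let $B_\kappa(s)=\frac{s}{e^{s/\kappa}-1}$ for $s\neq0$ and $B_\kappa(0)=\kappa$. A solution of the Scharfetter--Gummel scheme is a sequence $(\rho^n)_{n\ge0}$, $\rho^n=\{\rho^n_K\}_{K\in\mathcal T^h}$, such that for all $n\ge 0$ and $K\in\mathcal T^h$ $$|K|\frac{\rho_K^{n+1}-\rho_K^n}{\delta t}+\sum_{L\sim K}F_{KL}^{n+1}=0,\qquad F_{KL}^{n+1}=\tau_{KL}\big(B_\kappa(d_{KL}q_{LK}^{n+1})\rho_K^{n+1}-B_\kappa(d_{KL}q_{KL}^{n+1})\rho_L^{n+1}\big),$$ $$q_{KL}^{n+1}=\sum_{J\in\mathcal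 T^h}|J|\,\frac{\rho_J^{n+1}+\rho_J^n}{2}\,\frac{W(x_K-x_J)-W(x_L-x_J)}{d_{KL}}.$$ For such solutions $\rho^n_K>0$ for all $K$ and all $n\ge1$. Note that $\mathcal D^h(\rho^{n+1})$ also depends on $\rho^n$ through $q^{n+1}_{KL}$. Energies. $\mathcal F^h(\rho)=\kappa\sum_K|K|\rho_K\log\rho_K+\frac12\sum_{K,L}|K||L|W(x_K-x_L)\rho_K\rho_L$ and $\mathcal H(\rho\mid\tilde\rho)=\sum_K|K|\rho_K\log\frac{\rho_K}{\tilde\rho_K}$, with the convention $0\log0=0$. *)

theory Defs
  imports "HOL-Analysis.Analysis"
begin

section \<open>Regularity of functions and of domains\<close>

text \<open>Only meant for open \<open>S\<close>: all iterated partial derivatives up to order \<open>k\<close> exist and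
  are continuous. The total derivative demanded below is no restriction, since continuous partial
  derivatives already imply it.\<close>

fun Ck_on :: "nat \<Rightarrow> 'a::euclidean_space set \<Rightarrow> ('a \<Rightarrow> real) \<Rightarrow> bool" where
  "Ck_on 0 S f \<longleftrightarrow> continuous_on S f"
| "Ck_on (Suc k) S f \<longleftrightarrow>
     (\<forall>x\<in>S. f differentiable (at x)) \<and>
     (\<forall>b\<in>Basis. Ck_on k S (\<lambda>x. frechet_derivative f (at x) b))"

definition smooth_boundary :: "'a::euclidean_space set \<Rightarrow> bool" where
  "smooth_boundary \<Omega> \<longleftrightarrow>
     (\<forall>p\<in>frontier \<Omega>. \<exists>U \<phi>. open U \<and> p \<in> U \<and>
        (\<forall>k. Ck_on k U \<phi>) \<and>
        (\<forall>x\<in>U. frechet_derivative \<phi> (at x) \<noteq> (\<lambda>_. 0)) \<and>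
        \<Omega> \<inter> U = {x \<in> U. \<phi> x < 0} \<and>
        frontier \<Omega> \<inter> U = {x \<in> U. \<phi> x = 0})"

definition smooth_bounded_domain :: "'a::euclidean_space set \<Rightarrow> bool" where
  "smooth_bounded_domain \<Omega> \<longleftrightarrow>
     open \<Omega> \<and> connected \<Omega> \<and> \<Omega> \<noteq> {} \<and> bounded \<Omega> \<and> smooth_boundary \<Omega>"


section \<open>Area of faces\<close>

text \<open>Hausdorff measure, normalised so that on \<open>s\<close>-dimensional affine subspaces it is the
  \<open>s\<close>-dimensional Lebesgue measure. For \<open>s = 0\<close> a nonempty covering set contributes 1
  (\<open>0 ^ 0 = 1\<close>), which gives the counting measure. The restriction to bounded covering sets is
  needed because \<open>diameter\<close> has no meaning on unbounded sets.\<close>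

definition hausdorff_pre :: "nat \<Rightarrow> real \<Rightarrow> 'a::metric_space set \<Rightarrow> ennreal" where
  "hausdorff_pre s \<delta> A =
     (INF U \<in> {U :: nat \<Rightarrow> 'a set. A \<subseteq> (\<Union>i. U i) \<and> (\<forall>i. bounded (U i) \<and> diameter (U i) \<le> \<delta>)}.
        \<Sum>i. if U i = {} then 0 else ennreal (unit_ball_vol (real s) * (diameter (U i) / 2) ^ s))"

definition hausdorff_measure :: "nat \<Rightarrow> 'a::metric_space set \<Rightarrow> ennreal" where
  "hausdorff_measure s A = (SUP \<delta> \<in> {0<..}. hausdorff_pre s \<delta> A)"

definition area :: "'a::euclidean_space set \<Rightarrow> real" where
  "area A = enn2real (hausdorff_measure (DIM('a) - 1) A)"

abbreviation vol :: "'a::euclidean_space set \<Rightarrow> real" where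
  "vol K \<equiv> measure lebesgue K"


section \<open>Voronoi meshes\<close>

definition voronoi_cell :: "'a::metric_space set \<Rightarrow> 'a \<Rightarrow> 'a set" where
  "voronoi_cell G p = {y. \<forall>z\<in>G. dist y p \<le> dist y z}"

text \<open>A mesh is a finite set \<open>T\<close> of cells, taken from the tessellation of the whole space that is
  generated by a locally finite set \<open>G\<close>, together with the map \<open>gen\<close> from cells to generators.
  The set \<open>G\<close> may contain further points, whose cells do not belong to the mesh.\<close>

definition voronoi_mesh ::
  "'a::euclidean_space set \<Rightarrow> real \<Rightarrow> 'a set set \<Rightarrow> ('a set \<Rightarrow> 'a) \<Rightarrow> bool" where
  "voronoi_mesh \<Omega> h T gen \<longleftrightarrow>
     finite T \<and>
     (\<exists>G. (\<forall>B. bounded B \<longrightarrow> finite (G \<inter> B)) \<and>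
          (\<forall>K\<in>T. gen K \<in> G \<and> K = voronoi_cell G (gen K))) \<and>
     \<Omega> \<subseteq> \<Union>T \<and>
     (\<forall>K\<in>T. compact K \<and> K \<inter> \<Omega> \<noteq> {} \<and> diameter K \<le> h)"

definition neighbors :: "'a::euclidean_space set set \<Rightarrow> 'a set \<Rightarrow> 'a set set" where
  "neighbors T K = {L \<in> T. L \<noteq> K \<and> area (K \<inter> L) > 0}"

definition cdist :: "('a set \<Rightarrow> 'a::euclidean_space) \<Rightarrow> 'a set \<Rightarrow> 'a set \<Rightarrow> real" where
  "cdist gen K L = dist (gen K) (gen L)"

definition transmission :: "('a set \<Rightarrow> 'a::euclidean_space) \<Rightarrow> 'a set \<Rightarrow> 'a set \<Rightarrow> real" where
  "transmission gen K L = area (K \<inter> L) / cdist gen K L"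

definition discrete_probabilities :: "'a::euclidean_space set set \<Rightarrow> ('a set \<Rightarrow> real) set" where
  "discrete_probabilities T = {\<rho>. (\<forall>K\<in>T. 0 \<le> \<rho> K) \<and> (\<Sum>K\<in>T. vol K * \<rho> K) = 1}"


section \<open>The Scharfetter--Gummel scheme\<close>

definition bernoulli_fun :: "real \<Rightarrow> real \<Rightarrow> real" where
  "bernoulli_fun \<kappa> s = (if s = 0 then \<kappa> else s / (exp (s / \<kappa>) - 1))"

text \<open>In the following, \<open>\<rho>\<close> is the old and \<open>\<rho>'\<close> the new time step.\<close>

definition drift ::
  "('a::euclidean_space \<Rightarrow> real) \<Rightarrow> 'a set set \<Rightarrow> ('a set \<Rightarrow> 'a) \<Rightarrow>
   ('a set \<Rightarrow> real) \<Rightarrow> ('a set \<Rightarrow> real) \<Rightarrow> 'a set \<Rightarrow> 'a set \<Rightarrow> real" where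
  "drift W T gen \<rho> \<rho>' K L =
     (\<Sum>J\<in>T. vol J * ((\<rho>' J + \<rho> J) / 2) *
        ((W (gen K - gen J) - W (gen L - gen J)) / cdist gen K L))"

definition SG_flux ::
  "real \<Rightarrow> ('a::euclidean_space \<Rightarrow> real) \<Rightarrow> 'a set set \<Rightarrow> ('a set \<Rightarrow> 'a) \<Rightarrow>
   ('a set \<Rightarrow> real) \<Rightarrow> ('a set \<Rightarrow> real) \<Rightarrow> 'a set \<Rightarrow> 'a set \<Rightarrow> real" where
  "SG_flux \<kappa> W T gen \<rho> \<rho>' K L =
     transmission gen K L *
       (bernoulli_fun \<kappa> (cdist gen K L * drift W T gen \<rho> \<rho>' L K) * \<rho>' K -
        bernoulli_fun \<kappa> (cdist gen K L * drift W T gen \<rho> \<rho>' K L) * \<rho>' L)"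

definition SG_solution ::
  "real \<Rightarrow> real \<Rightarrow> ('a::euclidean_space \<Rightarrow> real) \<Rightarrow> 'a set set \<Rightarrow> ('a set \<Rightarrow> 'a) \<Rightarrow>
   (nat \<Rightarrow> 'a set \<Rightarrow> real) \<Rightarrow> bool" where
  "SG_solution \<kappa> \<tau> W T gen \<rho> \<longleftrightarrow>
     (\<forall>n. \<forall>K\<in>T.
        vol K * ((\<rho> (Suc n) K - \<rho> n K) / \<tau>) +
        (\<Sum>L\<in>neighbors T K. SG_flux \<kappa> W T gen (\<rho> n) (\<rho> (Suc n)) K L) = 0)"


section \<open>Energies and dissipation\<close>

text \<open>The convention \<open>0 log 0 = 0\<close> is automatic. The relative entropy is only
  meaningful where \<open>\<sigma>\<close> is positive (or \<open>\<rho>\<close> vanishes as well); its infinite value in the other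
  cases is not modelled, and it does not occur for solutions of the scheme.\<close>

definition free_energy ::
  "real \<Rightarrow> ('a::euclidean_space \<Rightarrow> real) \<Rightarrow> 'a set set \<Rightarrow> ('a set \<Rightarrow> 'a) \<Rightarrow>
   ('a set \<Rightarrow> real) \<Rightarrow> real" where
  "free_energy \<kappa> W T gen \<rho> =
     \<kappa> * (\<Sum>K\<in>T. vol K * \<rho> K * ln (\<rho> K)) +
     1/2 * (\<Sum>K\<in>T. \<Sum>L\<in>T. vol K * vol L * W (gen K - gen L) * \<rho> K * \<rho> L)"

definition rel_entropy ::
  "'a::euclidean_space set set \<Rightarrow> ('a set \<Rightarrow> real) \<Rightarrow> ('a set \<Rightarrow> real) \<Rightarrow> real" where
  "rel_entropy T \<rho> \<sigma> = (\<Sum>K\<in>T. vol K * \<rho> K * ln (\<rho> K / \<sigma> K))"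

definition theta_fun :: "real \<Rightarrow> real \<Rightarrow> real \<Rightarrow> real \<Rightarrow> real" where
  "theta_fun \<kappa> a b v =
     (if v = 0 then \<kappa> * (a - b)
      else v * ((a * exp (v / (2 * \<kappa>)) - b * exp (- (v / (2 * \<kappa>)))) /
                (exp (v / (2 * \<kappa>)) - exp (- (v / (2 * \<kappa>))))))"

definition alpha_fun :: "real \<Rightarrow> real \<Rightarrow> real \<Rightarrow> real \<Rightarrow> real" where
  "alpha_fun \<kappa> a b v =
     (ln (a * exp (v / (2 * \<kappa>))) - ln (b * exp (- (v / (2 * \<kappa>))))) * theta_fun \<kappa> a b v"

definition dissipation ::
  "real \<Rightarrow> ('a::euclidean_space \<Rightarrow> real) \<Rightarrow> 'a set set \<Rightarrow> ('a set \<Rightarrow> 'a) \<Rightarrow>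
   ('a set \<Rightarrow> real) \<Rightarrow> ('a set \<Rightarrow> real) \<Rightarrow> real" where
  "dissipation \<kappa> W T gen \<rho> \<rho>' =
     1/2 * (\<Sum>K\<in>T. \<Sum>L\<in>neighbors T K.
        \<kappa> * area (K \<inter> L) / cdist gen K L *
        alpha_fun \<kappa> (\<rho>' K) (\<rho>' L) (cdist gen K L * drift W T gen \<rho> \<rho>' K L))"

end

theory Submission
  imports Defs
begin

text \<open>Let \<open>V\<close> be the potential that the time-averaged density generates. Then
  \<open>d\<^sub>K\<^sub>L q\<^sub>K\<^sub>L = V\<^sub>K - V\<^sub>L\<close>, and because \<open>W\<close> is even the left-hand side of the identity collapses to
  \<open>\<Sum>\<^sub>K |K| (\<rho>'\<^sub>K - \<rho>\<^sub>K) (\<kappa> log \<rho>'\<^sub>K + V\<^sub>K) / \<tau>\<close>. Inserting the scheme and summing by parts yields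
  \<open>- 1/2 \<Sum>\<^sub>K \<Sum>\<^sub>L F\<^sub>K\<^sub>L (\<kappa> log \<rho>'\<^sub>K - \<kappa> log \<rho>'\<^sub>L + V\<^sub>K - V\<^sub>L)\<close>, and each summand is the one of the
  dissipation since \<open>F\<^sub>K\<^sub>L = |K|L| / d\<^sub>K\<^sub>L \<theta>\<^sub>\<kappa>\<close>.

  Nonnegativity follows by adding up the scheme over the cells with a negative value. Strict positivity
  would need connectedness of the neighbor graph, which is avoided: where \<open>\<rho>'\<close> vanishes, so
  do \<open>\<rho>\<close> and the neighboring values of \<open>\<rho>'\<close>, and all terms in question are zero.\<close>

section \<open>Geometry of the mesh\<close>

text \<open>Local finiteness keeps the other generators at a positive distance from
  \<open>p\<close>, and half of that distance is a safe radius. This is the source of the positive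
  cell volumes.\<close>

lemma cball_subset_voronoi_cell:
  fixes p :: "'a::metric_space"
  assumes "\<And>B. bounded B \<Longrightarrow> finite (G \<inter> B)"
  obtains r where "r > 0" "cball p r \<subseteq> voronoi_cell G p"
proof -
  have "finite (G \<inter> ball p 1)"
    using assms by simp
  then obtain d where d: "d > 0" "\<And>z. z \<in> G \<inter> ball p 1 \<Longrightarrow> z \<noteq> p \<Longrightarrow> d \<le> dist p z"
    using finite_set_avoid[of "G \<inter> ball p 1" p] by blast
  \<comment> \<open>\<open>d\<close> separates \<open>p\<close> from generators within distance 1,
    and the bound 1 handles all others. With \<open>2 * r \<le> dist p z\<close>, the triangle
    inequality gives \<open>dist y z \<ge> r \<ge> dist y p\<close>.\<close>
  define r where "r = min d 1 / 2"
  have "dist y p \<le> dist y z" if "y \<in> cball p r" "z \<in> G" for y z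
  proof (cases "z = p")
    case False
    have "2 * r \<le> dist p z"
    proof (cases "z \<in> ball p 1")
      case True
      then show ?thesis using d(2)[of z] that(2) False by (auto simp: r_def)
    qed (auto simp: r_def)
    moreover have "dist p z \<le> dist y p + dist y z"
      by (metis dist_commute dist_triangle)
    ultimately show ?thesis
      using that(1) by (simp add: dist_commute)
  qed simp
  then have "cball p r \<subseteq> voronoi_cell G p"
    unfolding voronoi_cell_def by blast
  moreover have "r > 0" using d(1) by (simp add: r_def)
  ultimately show ?thesis using that by blast
qed

lemma voronoi_mesh_vol_pos:
  assumes "voronoi_mesh \<Omega> h T gen" "K \<in> T"
  shows "vol K > 0"
proof -
  obtain G where G: "\<forall>B. bounded B \<longrightarrow> finite (G \<inter> B)"
    and cells: "\<forall>K\<in>T. gen K \<in> G \<and> K = voronoi_cell G (gen K)"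
    using assms(1) unfolding voronoi_mesh_def by (elim conjE exE)
  have cell: "K = voronoi_cell G (gen K)"
    using bspec[OF cells assms(2)] by (rule conjunct2)
  have K: "compact K"
    using assms by (simp add: voronoi_mesh_def)
  obtain r where r: "r > 0" "cball (gen K) r \<subseteq> voronoi_cell G (gen K)"
    using cball_subset_voronoi_cell[of G "gen K"] G by blast
  have "0 < vol (cball (gen K) r)"
    using r(1) by (simp add: content_cball)
  also have "\<dots> \<le> vol K"
  proof (rule measure_mono_fmeasurable)
    show "cball (gen K) r \<subseteq> K" using r(2) cell by (rule subset_trans[OF _ equalityD2])
  qed (use K lmeasurable_compact in auto)
  finally show ?thesis .
qed

text \<open>A cell is determined by its generator, so distinct cells have distinct
  generators.\<close>

lemma voronoi_mesh_cdist_pos: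
  assumes "voronoi_mesh \<Omega> h T gen" "K \<in> T" "L \<in> T" "K \<noteq> L"
  shows "cdist gen K L > 0"
proof -
  have "\<exists>G. \<forall>K\<in>T. gen K \<in> G \<and> K = voronoi_cell G (gen K)"
    using assms(1) by (auto simp: voronoi_mesh_def)
  then have "gen K \<noteq> gen L"
    using assms(2-4) by metis
  then show ?thesis by (simp add: cdist_def)
qed

lemma cdist_commute: "cdist gen K L = cdist gen L K"
  by (simp add: cdist_def dist_commute)

lemma transmission_commute: "transmission gen K L = transmission gen L K"
  by (simp add: transmission_def cdist_commute Int_commute)

lemma neighbors_sym: "K \<in> T \<Longrightarrow> L \<in> neighbors T K \<Longrightarrow> K \<in> neighbors T L"
  by (auto simp: neighbors_def Int_commute)

lemma neighbors_subset: "neighbors T K \<subseteq> T"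
  by (auto simp: neighbors_def)

lemma voronoi_mesh_transmission_pos:
  assumes "voronoi_mesh \<Omega> h T gen" "K \<in> T" "L \<in> neighbors T K"
  shows "transmission gen K L > 0"
proof -
  have "L \<in> T" "K \<noteq> L" "area (K \<inter> L) > 0"
    using assms(3) by (simp_all add: neighbors_def eq_commute[of K])
  then show ?thesis
    using voronoi_mesh_cdist_pos[OF assms(1,2)] by (simp add: transmission_def)
qed

text \<open>Symmetry of the neighbor relation allows relabelling the two cells of a pair. The
  restriction to \<open>S\<close> serves the sum over cells of negative value; \<open>S = T\<close>
  serves the dissipation.\<close>

lemma sum_neighbors_swap:
  fixes f :: "'a::euclidean_space set \<Rightarrow> 'a set \<Rightarrow> real"
  assumes "finite S" "S \<subseteq> T"
  shows "(\<Sum>K\<in>S. \<Sum>L\<in>neighbors T K \<inter> S. f K L) = (\<Sum>K\<in>S. \<Sum>L\<in>neighbors T K \<inter> S. f L K)"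
proof -
  let ?R = "\<lambda>K L. L \<in> neighbors T K"
  have "neighbors T K \<inter> S = {L \<in> S. ?R K L}" "neighbors T K \<inter> S = {L \<in> S. ?R L K}"
    if "K \<in> S" for K
    using that assms(2) neighbors_sym[of K T] neighbors_sym[of _ T K] by blast+
  then show ?thesis
    using sum.swap_restrict[OF assms(1) assms(1), of f ?R] by simp
qed

section \<open>The Scharfetter--Gummel flux\<close>

lemma bernoulli_fun_pos:
  assumes "\<kappa> > 0"
  shows "bernoulli_fun \<kappa> s > 0"
proof (cases s "0 :: real" rule: linorder_cases)
  case less
  then have "exp (s / \<kappa>) < 1"
    using assms by (simp add: divide_less_0_iff)
  then show ?thesis
    using less by (simp add: bernoulli_fun_def divide_neg_neg)
next
  case greater
  then have "exp (s / \<kappa>) > 1"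
    using assms by simp
  then show ?thesis
    using greater by (simp add: bernoulli_fun_def)
qed (simp add: bernoulli_fun_def assms)

text \<open>Expanding the quotient by exp(v/(2\<kappa>)) turns the symmetric form into the two
  Bernoulli weights, which identifies the flux with a multiple of \<open>theta_fun\<close>.\<close>

lemma theta_fun_eq_bernoulli:
  assumes "\<kappa> > 0"
  shows "theta_fun \<kappa> a b v = bernoulli_fun \<kappa> (- v) * a - bernoulli_fun \<kappa> v * b"
proof (cases "v = 0")
  case True
  then show ?thesis
    by (simp add: theta_fun_def bernoulli_fun_def algebra_simps)
next
  case False
  define E where "E = exp (v / (2 * \<kappa>))"
  have E: "E > 0" by (simp add: E_def)
  have E2: "exp (v / \<kappa>) = E\<^sup>2"
    by (simp add: E_def exp_double[symmetric])
  have En: "exp (- (v / \<kappa>)) = 1 / E\<^sup>2"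
    using E2 by (simp add: exp_minus inverse_eq_divide)
  have "exp (v / \<kappa>) \<noteq> 1"
    using False assms by simp
  then have E1: "E\<^sup>2 - 1 \<noteq> 0"
    using E2 by simp
  have "theta_fun \<kappa> a b v = v * ((a * E - b * (1 / E)) / (E - 1 / E))"
    using False by (simp add: theta_fun_def E_def exp_minus inverse_eq_divide)
  also have "(a * E - b * (1 / E)) / (E - 1 / E) = (a * E\<^sup>2 - b) / (E\<^sup>2 - 1)"
  proof -
    have "(a * E - b * (1 / E)) = (a * E\<^sup>2 - b) / E" "E - 1 / E = (E\<^sup>2 - 1) / E"
      using E by (simp_all add: field_simps power2_eq_square)
    then show ?thesis using E by simp
  qed
  also have "v * \<dots> = v * E\<^sup>2 / (E\<^sup>2 - 1) * a - v / (E\<^sup>2 - 1) * b"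
    by (simp add: diff_divide_distrib right_diff_distrib mult_ac)
  also have "v / (E\<^sup>2 - 1) = bernoulli_fun \<kappa> v"
    using False E2 by (simp add: bernoulli_fun_def)
  also have "v * E\<^sup>2 / (E\<^sup>2 - 1) = bernoulli_fun \<kappa> (- v)"
  proof -
    have "1 / E\<^sup>2 - 1 = - ((E\<^sup>2 - 1) / E\<^sup>2)"
      using E by (simp add: field_simps)
    then show ?thesis
      using False En by (simp add: bernoulli_fun_def)
  qed
  finally show ?thesis .
qed

lemma alpha_fun_zero [simp]: "alpha_fun \<kappa> 0 0 v = 0"
  by (simp add: alpha_fun_def theta_fun_def)

lemma alpha_fun_eq:
  assumes "\<kappa> > 0" "a > 0" "b > 0"
  shows "\<kappa> * alpha_fun \<kappa> a b v = (\<kappa> * ln a - \<kappa> * ln b + v) * theta_fun \<kappa> a b v"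
proof -
  have "ln (a * exp (v / (2 * \<kappa>))) - ln (b * exp (- (v / (2 * \<kappa>)))) = ln a - ln b + v / \<kappa>"
    using assms by (simp add: ln_mult field_simps)
  moreover have "\<kappa> * (ln a - ln b + v / \<kappa>) = \<kappa> * ln a - \<kappa> * ln b + v"
    using assms by (simp add: algebra_simps)
  ultimately show ?thesis
    unfolding alpha_fun_def by (metis mult.assoc)
qed

lemma alpha_fun_nonneg:
  assumes "\<kappa> > 0" "a > 0" "b > 0"
  shows "alpha_fun \<kappa> a b v \<ge> 0"
proof -
  define x y where "x = a * exp (v / (2 * \<kappa>))" and "y = b * exp (- (v / (2 * \<kappa>)))"
  \<comment> \<open>\<open>c\<close> merges both branches of \<open>theta_fun\<close> into
    \<open>c * (x - y)\<close>: for v = 0 the exponentials equal 1, so x - y = a - b. Nonnegativity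
    of \<alpha> is then monotonicity of \<open>ln\<close> together with
    \<open>c \<ge> 0\<close>.\<close>
  define c where
    "c = (if v = 0 then \<kappa> else v / (exp (v / (2 * \<kappa>)) - exp (- (v / (2 * \<kappa>)))))"
  have "x > 0" "y > 0"
    using assms by (simp_all add: x_def y_def)
  then have xy: "(ln x - ln y) * (x - y) \<ge> 0"
    by (cases "x \<le> y") (auto intro: mult_nonneg_nonneg mult_nonpos_nonpos)
  have "c \<ge> 0"
  proof (cases "v \<ge> 0")
    case True
    then have "exp (- (v / (2 * \<kappa>))) \<le> exp (v / (2 * \<kappa>))"
      using assms by simp
    then show ?thesis
      using True assms by (simp add: c_def)
  next
    case False
    then have "v / (2 * \<kappa>) \<le> 0"
      using assms by (simp add: divide_le_0_iff)
    then have "exp (v / (2 * \<kappa>)) \<le> exp (- (v / (2 * \<kappa>)))"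
      by simp
    then show ?thesis
      using False assms by (simp add: c_def divide_nonpos_nonpos)
  qed
  moreover have "theta_fun \<kappa> a b v = c * (x - y)"
    by (simp add: theta_fun_def c_def x_def y_def)
  moreover have "alpha_fun \<kappa> a b v = (ln x - ln y) * theta_fun \<kappa> a b v"
    by (simp add: alpha_fun_def x_def y_def)
  ultimately show ?thesis
    using mult_nonneg_nonneg[OF _ xy, of c] by (simp add: mult_ac)
qed

lemma SG_flux_antisym: "SG_flux \<kappa> W T gen \<rho> \<rho>' K L = - SG_flux \<kappa> W T gen \<rho> \<rho>' L K"
  unfolding SG_flux_def cdist_commute[of gen K L] transmission_commute[of gen K L]
  by (simp add: right_diff_distrib)

definition mean_potential ::
  "('a::euclidean_space \<Rightarrow> real) \<Rightarrow> 'a set set \<Rightarrow> ('a set \<Rightarrow> 'a) \<Rightarrow>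
   ('a set \<Rightarrow> real) \<Rightarrow> ('a set \<Rightarrow> real) \<Rightarrow> 'a set \<Rightarrow> real" where
  "mean_potential W T gen \<rho> \<rho>' K = (\<Sum>J\<in>T. vol J * ((\<rho>' J + \<rho> J) / 2) * W (gen K - gen J))"

text \<open>The distance cancels the denominator of the drift. The drift is thus a discrete
  gradient, antisymmetric in the two cells.\<close>

lemma cdist_drift:
  assumes "cdist gen K L > 0"
  shows "cdist gen K L * drift W T gen \<rho> \<rho>' K L =
    mean_potential W T gen \<rho> \<rho>' K - mean_potential W T gen \<rho> \<rho>' L"
  unfolding drift_def mean_potential_def sum_distrib_left sum_subtractf[symmetric]
  using assms by (intro sum.cong) (auto simp: field_simps)

lemma SG_flux_eq_theta:
  assumes "\<kappa> > 0" "cdist gen K L > 0"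
  shows "SG_flux \<kappa> W T gen \<rho> \<rho>' K L =
    transmission gen K L * theta_fun \<kappa> (\<rho>' K) (\<rho>' L) (cdist gen K L * drift W T gen \<rho> \<rho>' K L)"
proof -
  have "cdist gen K L * drift W T gen \<rho> \<rho>' L K = - (cdist gen K L * drift W T gen \<rho> \<rho>' K L)"
    using cdist_drift[of gen K L W T \<rho> \<rho>'] cdist_drift[of gen L K W T \<rho> \<rho>'] assms(2)
    unfolding cdist_commute[of gen L K] by linarith
  then show ?thesis
    by (simp add: SG_flux_def theta_fun_eq_bernoulli[OF assms(1)])
qed

section \<open>One step of the scheme\<close>

text \<open>One time step in isolation. Nonnegativity of the old density is the property that passes
  from step to step.\<close>

locale SG_step =
  fixes \<Omega> :: "'a::euclidean_space set" and h :: real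
    and T :: "'a set set" and gen :: "'a set \<Rightarrow> 'a"
    and \<kappa> \<tau> :: real and W :: "'a \<Rightarrow> real" and \<rho> \<rho>' :: "'a set \<Rightarrow> real"
  assumes mesh: "voronoi_mesh \<Omega> h T gen"
    and kappa_pos: "\<kappa> > 0" and tau_pos: "\<tau> > 0"
    and W_even: "\<And>x. W x = W (- x)"
    and old_nonneg: "\<And>K. K \<in> T \<Longrightarrow> \<rho> K \<ge> 0"
    and scheme: "\<And>K. K \<in> T \<Longrightarrow>
      vol K * ((\<rho>' K - \<rho> K) / \<tau>) + (\<Sum>L\<in>neighbors T K. SG_flux \<kappa> W T gen \<rho> \<rho>' K L) = 0"
begin

abbreviation "F \<equiv> SG_flux \<kappa> W T gen \<rho> \<rho>'"
abbreviation "V \<equiv> mean_potential W T gen \<rho> \<rho>'"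

lemma finite_mesh: "finite T"
  using mesh by (simp add: voronoi_mesh_def)

lemma finite_neighbors: "finite (neighbors T K)"
  using finite_mesh neighbors_subset by (rule finite_subset[rotated])

lemma vol_pos: "K \<in> T \<Longrightarrow> vol K > 0"
  using voronoi_mesh_vol_pos mesh by blast

lemma neighbors_cdist_pos: "K \<in> T \<Longrightarrow> L \<in> neighbors T K \<Longrightarrow> cdist gen K L > 0"
  using voronoi_mesh_cdist_pos[OF mesh] by (auto simp: neighbors_def)

text \<open>Both Bernoulli weights are positive whatever the drift, so the flux increases in the
  value at \<open>K\<close> and decreases in that at \<open>L\<close>. The sign arguments below use
  only this monotonicity.\<close>

lemma flux_upwind:
  assumes "K \<in> T" "L \<in> neighbors T K"
  obtains c c' where "c > 0" "c' > 0" "F K L = c * \<rho>' K - c' * \<rho>' L"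
proof
  show "transmission gen K L * bernoulli_fun \<kappa> (cdist gen K L * drift W T gen \<rho> \<rho>' L K) > 0"
    "transmission gen K L * bernoulli_fun \<kappa> (cdist gen K L * drift W T gen \<rho> \<rho>' K L) > 0"
    using voronoi_mesh_transmission_pos[OF mesh assms] bernoulli_fun_pos[OF kappa_pos] by simp_all
qed (simp add: SG_flux_def algebra_simps)

section \<open>Nonnegativity of the new density and its zeros\<close>

lemma new_nonneg:
  assumes "K \<in> T"
  shows "\<rho>' K \<ge> 0"
proof (rule ccontr)
  assume neg: "\<not> \<rho>' K \<ge> 0"
  define N where "N = {K \<in> T. \<rho>' K < 0}"
  have N: "finite N" "N \<subseteq> T" "K \<in> N"
    using finite_mesh assms neg by (auto simp: N_def)
  \<comment> \<open>Fluxes between two cells of \<open>N\<close> cancel by antisymmetry.\<close>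
  have inner: "(\<Sum>K\<in>N. \<Sum>L\<in>neighbors T K \<inter> N. F K L) = 0"
  proof -
    have "(\<Sum>K\<in>N. \<Sum>L\<in>neighbors T K \<inter> N. F K L) = (\<Sum>K\<in>N. \<Sum>L\<in>neighbors T K \<inter> N. F L K)"
      using N by (intro sum_neighbors_swap)
    also have "\<dots> = - (\<Sum>K\<in>N. \<Sum>L\<in>neighbors T K \<inter> N. F K L)"
      unfolding sum_negf[symmetric] by (intro sum.cong refl SG_flux_antisym)
    finally show ?thesis by simp
  qed
  \<comment> \<open>Flux across the boundary of \<open>N\<close> can only enter \<open>N\<close>,
    while the total over \<open>N\<close> of the time differences is negative: the two cannot add up
    to zero.\<close>
  have outer: "F K L \<le> 0" if KL: "K \<in> N" "L \<in> neighbors T K - N" for K L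
  proof -
    obtain c c' where "c > 0" "c' > 0" "F K L = c * \<rho>' K - c' * \<rho>' L"
      using flux_upwind[of K L] KL N(2) by blast
    moreover have "\<rho>' K < 0" "\<rho>' L \<ge> 0"
      using KL neighbors_subset by (force simp: N_def)+
    ultimately show ?thesis
      by (smt (verit) mult_nonneg_nonneg mult_pos_neg)
  qed
  have "(\<Sum>L\<in>neighbors T K. F K L) =
      (\<Sum>L\<in>neighbors T K \<inter> N. F K L) + (\<Sum>L\<in>neighbors T K - N. F K L)" for K
    by (rule sum.Int_Diff[OF finite_neighbors])
  then have "(\<Sum>K\<in>N. \<Sum>L\<in>neighbors T K. F K L) = (\<Sum>K\<in>N. \<Sum>L\<in>neighbors T K - N. F K L)"
    using inner by (simp add: sum.distrib)
  also have "\<dots> \<le> 0"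
    using outer by (intro sum_nonpos) auto
  finally have "(\<Sum>K\<in>N. \<Sum>L\<in>neighbors T K. F K L) \<le> 0" .
  moreover have "(\<Sum>K\<in>N. vol K * ((\<rho>' K - \<rho> K) / \<tau>)) < 0"
  proof -
    have "vol K * ((\<rho>' K - \<rho> K) / \<tau>) < 0" if "K \<in> N" for K
    proof -
      have "\<rho>' K - \<rho> K < 0" "vol K > 0"
        using that old_nonneg[of K] vol_pos[of K] by (auto simp: N_def)
      then show ?thesis
        using tau_pos by (simp add: mult_pos_neg divide_neg_pos)
    qed
    then have "(\<Sum>K\<in>N. vol K * ((\<rho>' K - \<rho> K) / \<tau>)) < (\<Sum>K\<in>N. 0)"
      using N by (intro sum_strict_mono) auto
    then show ?thesis by simp
  qed
  moreover have "(\<Sum>K\<in>N. vol K * ((\<rho>' K - \<rho> K) / \<tau>)) + (\<Sum>K\<in>N. \<Sum>L\<in>neighbors T K. F K L) = 0"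
    unfolding sum.distrib[symmetric] using scheme N(2) by (intro sum.neutral) auto
  ultimately show False by linarith
qed

text \<open>At a zero of \<open>\<rho>'\<close>, the time difference and every flux in the scheme
  are nonpositive. Since they sum to zero, each vanishes.\<close>

lemma new_zero:
  assumes "K \<in> T" "\<rho>' K = 0"
  shows "\<rho> K = 0" and "\<And>L. L \<in> neighbors T K \<Longrightarrow> \<rho>' L = 0"
proof -
  have flux: "F K L \<le> 0 \<and> (F K L = 0 \<longrightarrow> \<rho>' L = 0)" if L: "L \<in> neighbors T K" for L
  proof -
    obtain c c' where "c > 0" "c' > 0" "F K L = c * \<rho>' K - c' * \<rho>' L"
      using flux_upwind assms(1) L by blast
    then show ?thesis
      using assms(2) new_nonneg[of L] L neighbors_subset by fastforce
  qed
  have old: "vol K * ((\<rho>' K - \<rho> K) / \<tau>) = - (vol K * \<rho> K / \<tau>)"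
    using assms(2) by simp
  have "vol K * \<rho> K / \<tau> \<ge> 0"
    using old_nonneg vol_pos assms(1) tau_pos by (simp add: less_imp_le)
  moreover have "(\<Sum>L\<in>neighbors T K. F K L) \<le> 0"
    using flux by (intro sum_nonpos) blast
  ultimately have zero: "vol K * \<rho> K / \<tau> = 0" "(\<Sum>L\<in>neighbors T K. F K L) = 0"
    using scheme[OF assms(1)] old by linarith+
  show "\<rho> K = 0"
    using zero(1) vol_pos[OF assms(1)] tau_pos by simp
  show "\<rho>' L = 0" if "L \<in> neighbors T K" for L
  proof -
    have "(\<Sum>L\<in>neighbors T K. - F K L) = 0"
      using zero(2) by (simp add: sum_negf)
    then have "\<forall>L\<in>neighbors T K. - F K L = 0"
      using flux finite_neighbors by (subst (asm) sum_nonneg_eq_0_iff) auto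
    then show ?thesis
      using flux that by simp
  qed
qed

lemma neighbors_cases:
  assumes "K \<in> T" "L \<in> neighbors T K"
  obtains "\<rho>' K = 0" "\<rho>' L = 0" | "\<rho>' K > 0" "\<rho>' L > 0"
proof -
  have "L \<in> T" "K \<in> neighbors T L"
    using assms neighbors_subset neighbors_sym by blast+
  then have "\<rho>' K = 0 \<longleftrightarrow> \<rho>' L = 0" "\<rho>' K \<ge> 0" "\<rho>' L \<ge> 0"
    using new_zero(2) new_nonneg assms by blast+
  then show ?thesis
    using that by fastforce
qed

section \<open>The dissipation and its summation by parts\<close>

lemma dissipation_nonneg: "dissipation \<kappa> W T gen \<rho> \<rho>' \<ge> 0"
proof -
  have "\<kappa> * area (K \<inter> L) / cdist gen K L *
      alpha_fun \<kappa> (\<rho>' K) (\<rho>' L) (cdist gen K L * drift W T gen \<rho> \<rho>' K L) \<ge> 0"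
    if KL: "K \<in> T" "L \<in> neighbors T K" for K L
  proof (rule mult_nonneg_nonneg)
    show "\<kappa> * area (K \<inter> L) / cdist gen K L \<ge> 0"
      using kappa_pos by (simp add: area_def cdist_def)
    show "alpha_fun \<kappa> (\<rho>' K) (\<rho>' L) (cdist gen K L * drift W T gen \<rho> \<rho>' K L) \<ge> 0"
      using neighbors_cases[OF KL] alpha_fun_nonneg[OF kappa_pos] by (metis alpha_fun_zero order_refl)
  qed
  then show ?thesis
    unfolding dissipation_def by (simp add: sum_nonneg)
qed

lemma dissipation_eq:
  "dissipation \<kappa> W T gen \<rho> \<rho>' =
    (\<Sum>K\<in>T. (\<kappa> * ln (\<rho>' K) + V K) * (\<Sum>L\<in>neighbors T K. F K L))"
proof -
  let ?\<phi> = "\<lambda>K. \<kappa> * ln (\<rho>' K) + V K"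
  have edge: "\<kappa> * area (K \<inter> L) / cdist gen K L *
      alpha_fun \<kappa> (\<rho>' K) (\<rho>' L) (cdist gen K L * drift W T gen \<rho> \<rho>' K L) =
      ?\<phi> K * F K L + ?\<phi> L * F L K"
    if KL: "K \<in> T" "L \<in> neighbors T K" for K L
  proof -
    let ?v = "cdist gen K L * drift W T gen \<rho> \<rho>' K L"
    have d: "cdist gen K L > 0"
      using neighbors_cdist_pos KL by blast
    have "\<kappa> * alpha_fun \<kappa> (\<rho>' K) (\<rho>' L) ?v = (?\<phi> K - ?\<phi> L) * theta_fun \<kappa> (\<rho>' K) (\<rho>' L) ?v"
    proof (rule neighbors_cases[OF KL])
      \<comment> \<open>Here \<theta> is zero, so the value assigned to \<open>ln 0\<close> is
        irrelevant on both sides.\<close>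
      assume "\<rho>' K = 0" "\<rho>' L = 0"
      then show ?thesis by (simp add: theta_fun_def)
    next
      assume "\<rho>' K > 0" "\<rho>' L > 0"
      moreover have "\<kappa> * ln (\<rho>' K) - \<kappa> * ln (\<rho>' L) + ?v = ?\<phi> K - ?\<phi> L"
        using cdist_drift[OF d, of W T \<rho> \<rho>'] by simp
      ultimately show ?thesis
        by (simp only: alpha_fun_eq[OF kappa_pos])
    qed
    moreover have "\<kappa> * area (K \<inter> L) / cdist gen K L * alpha_fun \<kappa> (\<rho>' K) (\<rho>' L) ?v =
        transmission gen K L * (\<kappa> * alpha_fun \<kappa> (\<rho>' K) (\<rho>' L) ?v)"
      by (simp add: transmission_def)
    ultimately have "\<kappa> * area (K \<inter> L) / cdist gen K L * alpha_fun \<kappa> (\<rho>' K) (\<rho>' L) ?v =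
        (?\<phi> K - ?\<phi> L) * F K L"
      using SG_flux_eq_theta[OF kappa_pos d, of W T \<rho> \<rho>'] by simp
    then show ?thesis
      by (simp add: SG_flux_antisym[of \<kappa> W T gen \<rho> \<rho>' L K] algebra_simps)
  qed
  \<comment> \<open>Relabelling makes the two halves of each edge term contribute equally, which
    absorbs the factor 1/2.\<close>
  have "(\<Sum>K\<in>T. \<Sum>L\<in>neighbors T K. ?\<phi> L * F L K) = (\<Sum>K\<in>T. \<Sum>L\<in>neighbors T K. ?\<phi> K * F K L)"
    using sum_neighbors_swap[OF finite_mesh order_refl, of "\<lambda>K L. ?\<phi> L * F L K"]
    by (simp add: Int_absorb2 neighbors_subset)
  moreover have "dissipation \<kappa> W T gen \<rho> \<rho>' =
      1/2 * (\<Sum>K\<in>T. \<Sum>L\<in>neighbors T K. ?\<phi> K * F K L + ?\<phi> L * F L K)"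
    unfolding dissipation_def by (intro arg_cong2[of _ _ _ _ "(*)"] sum.cong refl edge)
  moreover have "1/2 * (x + x) = x" for x :: real
    by simp
  ultimately show ?thesis
    by (simp only: sum.distrib sum_distrib_left[symmetric])
qed

section \<open>Energy balance\<close>

lemma entropy_difference:
  assumes "K \<in> T"
  shows "\<rho>' K * ln (\<rho>' K) - \<rho> K * ln (\<rho> K) + \<rho> K * ln (\<rho> K / \<rho>' K) = (\<rho>' K - \<rho> K) * ln (\<rho>' K)"
proof (cases "\<rho> K = 0")
  case False
  \<comment> \<open>A zero of \<open>\<rho>'\<close> would force \<open>\<rho> K = 0\<close>, so the
    logarithm of the quotient may be split.\<close>
  then have "\<rho> K > 0" "\<rho>' K > 0"
    using old_nonneg new_nonneg new_zero(1) assms by (metis order_le_less)+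
  then show ?thesis
    by (simp add: ln_div algebra_simps)
qed simp

text \<open>For a symmetric bilinear form, B(\<rho>',\<rho>') - B(\<rho>,\<rho>) = B(\<rho>' -
  \<rho>, \<rho>' + \<rho>). This is why the scheme averages the two time levels in the drift: the
  identity is exact.\<close>

lemma interaction_difference:
  "1/2 * (\<Sum>K\<in>T. \<Sum>L\<in>T. vol K * vol L * W (gen K - gen L) * \<rho>' K * \<rho>' L) -
   1/2 * (\<Sum>K\<in>T. \<Sum>L\<in>T. vol K * vol L * W (gen K - gen L) * \<rho> K * \<rho> L) =
   (\<Sum>K\<in>T. vol K * (\<rho>' K - \<rho> K) * V K)"
proof -
  define w where "w K L = vol K * vol L * W (gen K - gen L)" for K L
  have w_sym: "w K L = w L K" for K L
    using W_even[of "gen K - gen L"] by (simp add: w_def)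
  \<comment> \<open>The mixed terms agree by evenness of \<open>W\<close>, so inserting them with
    opposite signs changes nothing and lets the product factor.\<close>
  have "(\<Sum>K\<in>T. \<Sum>L\<in>T. w K L * \<rho> K * \<rho>' L) = (\<Sum>K\<in>T. \<Sum>L\<in>T. w K L * \<rho>' K * \<rho> L)"
    by (subst sum.swap, intro sum.cong refl) (simp add: w_sym mult_ac)
  then have "1/2 * (\<Sum>K\<in>T. \<Sum>L\<in>T. w K L * \<rho>' K * \<rho>' L) - 1/2 * (\<Sum>K\<in>T. \<Sum>L\<in>T. w K L * \<rho> K * \<rho> L) =
      1/2 * ((\<Sum>K\<in>T. \<Sum>L\<in>T. w K L * \<rho>' K * \<rho>' L) + (\<Sum>K\<in>T. \<Sum>L\<in>T. w K L * \<rho>' K * \<rho> L) -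
        (\<Sum>K\<in>T. \<Sum>L\<in>T. w K L * \<rho> K * \<rho>' L) - (\<Sum>K\<in>T. \<Sum>L\<in>T. w K L * \<rho> K * \<rho> L))"
    by simp
  also have "\<dots> = (\<Sum>K\<in>T. \<Sum>L\<in>T. 1/2 * (w K L * (\<rho>' K - \<rho> K) * (\<rho>' L + \<rho> L)))"
    unfolding sum_distrib_left sum.distrib[symmetric] sum_subtractf[symmetric]
    by (intro sum.cong refl) (simp add: algebra_simps)
  also have "\<dots> = (\<Sum>K\<in>T. vol K * (\<rho>' K - \<rho> K) * V K)"
    unfolding mean_potential_def sum_distrib_left by (intro sum.cong) (auto simp: w_def)
  finally show ?thesis
    unfolding w_def .
qed

lemma energy_dissipation:
  "(free_energy \<kappa> W T gen \<rho>' - free_energy \<kappa> W T gen \<rho>) / \<tau> + \<kappa> * (rel_entropy T \<rho> \<rho>' / \<tau>) =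
    - dissipation \<kappa> W T gen \<rho> \<rho>'"
proof -
  have "(\<Sum>K\<in>T. vol K * \<rho>' K * ln (\<rho>' K)) - (\<Sum>K\<in>T. vol K * \<rho> K * ln (\<rho> K)) + rel_entropy T \<rho> \<rho>' =
      (\<Sum>K\<in>T. vol K * (\<rho>' K * ln (\<rho>' K) - \<rho> K * ln (\<rho> K) + \<rho> K * ln (\<rho> K / \<rho>' K)))"
    by (simp add: rel_entropy_def sum_subtractf sum.distrib algebra_simps)
  also have "\<dots> = (\<Sum>K\<in>T. vol K * ((\<rho>' K - \<rho> K) * ln (\<rho>' K)))"
    by (simp add: entropy_difference)
  finally have entropy: "\<kappa> * (\<Sum>K\<in>T. vol K * \<rho>' K * ln (\<rho>' K)) -
      \<kappa> * (\<Sum>K\<in>T. vol K * \<rho> K * ln (\<rho> K)) + \<kappa> * rel_entropy T \<rho> \<rho>' =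
      \<kappa> * (\<Sum>K\<in>T. vol K * ((\<rho>' K - \<rho> K) * ln (\<rho>' K)))"
    by (simp only: distrib_left[symmetric] right_diff_distrib[symmetric])
  have "free_energy \<kappa> W T gen \<rho>' - free_energy \<kappa> W T gen \<rho> + \<kappa> * rel_entropy T \<rho> \<rho>' =
      \<kappa> * (\<Sum>K\<in>T. vol K * ((\<rho>' K - \<rho> K) * ln (\<rho>' K))) + (\<Sum>K\<in>T. vol K * (\<rho>' K - \<rho> K) * V K)"
    unfolding free_energy_def using entropy interaction_difference by linarith
  also have "\<dots> = (\<Sum>K\<in>T. vol K * (\<rho>' K - \<rho> K) * (\<kappa> * ln (\<rho>' K) + V K))"
    unfolding sum_distrib_left sum.distrib[symmetric]
    by (intro sum.cong refl) (simp add: algebra_simps)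
  finally have "(free_energy \<kappa> W T gen \<rho>' - free_energy \<kappa> W T gen \<rho>) / \<tau> +
      \<kappa> * (rel_entropy T \<rho> \<rho>' / \<tau>) =
      (\<Sum>K\<in>T. vol K * (\<rho>' K - \<rho> K) * (\<kappa> * ln (\<rho>' K) + V K)) / \<tau>"
    by (simp add: add_divide_distrib[symmetric])
  also have "\<dots> = (\<Sum>K\<in>T. (\<kappa> * ln (\<rho>' K) + V K) * (vol K * ((\<rho>' K - \<rho> K) / \<tau>)))"
    unfolding sum_divide_distrib by (simp add: mult_ac)
  also have "\<dots> = (\<Sum>K\<in>T. (\<kappa> * ln (\<rho>' K) + V K) * (- (\<Sum>L\<in>neighbors T K. F K L)))"
    by (intro sum.cong refl arg_cong2[of _ _ _ _ "(*)"]) (use scheme in \<open>simp add: eq_neg_iff_add_eq_0\<close>)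
  also have "\<dots> = - dissipation \<kappa> W T gen \<rho> \<rho>'"
    by (simp add: dissipation_eq sum_negf)
  finally show ?thesis .
qed

end

theorem proposition1:
  fixes \<Omega> :: "(real ^ 'd) set" and h :: real
    and T :: "(real ^ 'd) set set" and gen :: "(real ^ 'd) set \<Rightarrow> real ^ 'd"
    and \<kappa> \<tau> :: real and W :: "real ^ 'd \<Rightarrow> real"
    and \<rho> :: "nat \<Rightarrow> (real ^ 'd) set \<Rightarrow> real"
  assumes "smooth_bounded_domain \<Omega>"
    and "voronoi_mesh \<Omega> h T gen"
    and "\<kappa> > 0" and "\<tau> > 0"
    and "\<And>x. W x = W (- x)" and "\<And>x. W x \<ge> 0"
    and "Ck_on 1 (UNIV - {0}) W"
    and "\<exists>C. C-lipschitz_on UNIV W"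
    and "SG_solution \<kappa> \<tau> W T gen \<rho>"
    and "\<rho> 0 \<in> discrete_probabilities T"
  shows "\<forall>n.
      (free_energy \<kappa> W T gen (\<rho> (Suc n)) - free_energy \<kappa> W T gen (\<rho> n)) / \<tau>
        + \<kappa> * (rel_entropy T (\<rho> n) (\<rho> (Suc n)) / \<tau>)
        = - dissipation \<kappa> W T gen (\<rho> n) (\<rho> (Suc n))
      \<and> dissipation \<kappa> W T gen (\<rho> n) (\<rho> (Suc n)) \<ge> 0"
proof -
  have step: "SG_step \<Omega> h T gen \<kappa> \<tau> W (\<rho> n) (\<rho> (Suc n))" if "\<forall>K\<in>T. \<rho> n K \<ge> 0" for n
    using assms(2-5,9) that by unfold_locales (auto simp: SG_solution_def)
  \<comment> \<open>Nonnegativity propagates from the initial probability, so every time step is an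
    instance of the locale.\<close>
  have "\<forall>K\<in>T. \<rho> n K \<ge> 0" for n
  proof (induction n)
    case 0
    then show ?case using assms(10) by (simp add: discrete_probabilities_def)
  next
    case (Suc n)
    then show ?case using SG_step.new_nonneg[OF step] by blast
  qed
  then show ?thesis
    using SG_step.energy_dissipation[OF step] SG_step.dissipation_nonneg[OF step] by blast
qed

end
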